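(* For all positive integers $n,p$, $$\beta(n,p,2)=\beta^*(n,p,2)=\Theta\left(\min\left\{np^{1/2},\,n^{2/3}p\right\}+n+p\right),$$ where the hidden constants are absolute.
   Context: A path system is a pair $S=(V,\Pi)$ where $V$ is a finite ground set of nodes and $\Pi$ is a multiset of finite sequences of nodes (called paths), each path containing each node at most once. The size of $S$ is $\|S\|=\sum_{\pi\in\Pi}|\pi|$, where $|\pi|$ is the number of nodes of $\pi$. For a path $\pi$, write $x<_\pi y$ if $x,y\in\pi$ and $x$ strictly precedes $y$ in $\pi$. A $b$-bridge in $S$ consists of $b$ distinct nodes $v_1,\dots,v_b$ and $b$ distinct paths $\pi_1,\dots,\pi_b\in\Pi$ such that $v_i<_{\pi_i}v_{i+1}$ for all $1\le i\le b-1$ and $v_1<_{\pi_b}v_b$; $\pi_b$ is called the river and $\pi_1,\dots,\pi_{b-1}$ the arcs. The bridge girth of $S$ is the least $b$ such that $S$ has a $b$-bridge ($\infty$ if none). $\beta(n,p,k)$ denotes the maximum possible size of a path system with $n$ nodes, $p$ paths and bridge girth $>k$ ($k=\infty$ allowed). An ordered path system is a path system together with a total order on its paths; an ordered bridge is a bridge whose river comes after all its arcs in this order; the ordered bridge girth is the least $b$ such that there is an ordered $b$-bridge. $\beta^*(n,p,k)$ denotes the maximum possible size of an ordered path system with $n$ nodes, $p$ paths and ordered bridge girth $>k$. *)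

theory Defs
  imports "HOL-Analysis.Analysis"
begin

text \<open>A path system with ground set V (nodes are naturals) and paths given as a list P
  (a list represents the multiset of paths; list positions give distinct path identities,
  and, for ordered path systems, the list order is the total order on the paths).\<close>

definition path_system :: "nat set \<Rightarrow> nat list list \<Rightarrow> bool" where
  "path_system V P \<longleftrightarrow> finite V \<and> (\<forall>\<pi>\<in>set P. distinct \<pi> \<and> set \<pi> \<subseteq> V)"

definition ps_size :: "nat list list \<Rightarrow> nat" where
  "ps_size P = sum_list (map length P)"

definition precedes :: "nat list \<Rightarrow> nat \<Rightarrow> nat \<Rightarrow> bool" where
  "precedes \<pi> x y \<longleftrightarrow> (\<exists>i j. i < j \<and> j < length \<pi> \<and> \<pi> ! i = x \<and> \<pi> ! j = y)"

text \<open>A b-bridge: nodes v 0,...,v (b-1) distinct, path indices q 0,...,q (b-1) distinct,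
  arcs q 0..q (b-2), river q (b-1).  (0-indexed version of the paper's definition.)\<close>
definition is_bridge :: "nat list list \<Rightarrow> nat \<Rightarrow> (nat \<Rightarrow> nat) \<Rightarrow> (nat \<Rightarrow> nat) \<Rightarrow> bool" where
  "is_bridge P b v q \<longleftrightarrow> b \<ge> 1 \<and>
     inj_on v {..<b} \<and> inj_on q {..<b} \<and> (\<forall>i<b. q i < length P) \<and>
     (\<forall>i. i + 1 < b \<longrightarrow> precedes (P ! q i) (v i) (v (i + 1))) \<and>
     precedes (P ! q (b - 1)) (v 0) (v (b - 1))"

definition has_bridge :: "nat list list \<Rightarrow> nat \<Rightarrow> bool" where
  "has_bridge P b \<longleftrightarrow> (\<exists>v q. is_bridge P b v q)"

definition has_ordered_bridge :: "nat list list \<Rightarrow> nat \<Rightarrow> bool" where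
  "has_ordered_bridge P b \<longleftrightarrow>
     (\<exists>v q. is_bridge P b v q \<and> (\<forall>i. i + 1 < b \<longrightarrow> q i < q (b - 1)))"

definition bridge_girth_gt :: "nat list list \<Rightarrow> nat \<Rightarrow> bool" where
  "bridge_girth_gt P k \<longleftrightarrow> (\<forall>b. b \<le> k \<longrightarrow> \<not> has_bridge P b)"

definition ordered_bridge_girth_gt :: "nat list list \<Rightarrow> nat \<Rightarrow> bool" where
  "ordered_bridge_girth_gt P k \<longleftrightarrow> (\<forall>b. b \<le> k \<longrightarrow> \<not> has_ordered_bridge P b)"

definition beta :: "nat \<Rightarrow> nat \<Rightarrow> nat \<Rightarrow> nat" where
  "beta n p k = Max {ps_size P | V P. path_system V P \<and> card V = n \<and> length P = p
                                     \<and> bridge_girth_gt P k}"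

definition beta_star :: "nat \<Rightarrow> nat \<Rightarrow> nat \<Rightarrow> nat" where
  "beta_star n p k = Max {ps_size P | V P. path_system V P \<and> card V = n \<and> length P = p
                                     \<and> ordered_bridge_girth_gt P k}"

end

theory Submission
  imports Defs "HOL-Computational_Algebra.Primes" "HOL-Real_Asymp.Real_Asymp"
begin

text \<open>
  A 2-bridge consists of two paths that traverse a common pair of nodes in the same order, so
  exchanging the two paths shows that the order of the paths is irrelevant.

  Upper bound: an ordered pair of nodes lies on at most one path, and three paths share at most one
  node, since two of the three would traverse a shared pair in the same order. Counting ordered pairs
  on the paths gives the bound with \<open>n p\<^bsup>1/2\<^esup>\<close>, and counting triples of paths through the nodes
  gives the bound with \<open>n\<^bsup>2/3\<^esup> p\<close>.

  Lower bound: identify a point \<open>(x, y, z)\<close> over the field with \<open>q\<close> elements with the polynomial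
  \<open>x + y T + z T\<^sup>2\<close>. The path \<open>(a, c)\<close> consists of the polynomials with value \<open>c\<close> at \<open>a\<close>, ordered by
  their derivative at \<open>a\<close>. If two polynomials lie on the paths \<open>(a, c)\<close> and \<open>(b, d)\<close>, then their
  difference has the roots \<open>a\<close> and \<open>b\<close>, so its derivatives there are negatives of each other and the
  pair is traversed in opposite directions. To make this meaningful for representatives of residues,
  only points whose derivative is in the lower half of \<open>{0..<q}\<close> are kept on a path.
  For general \<open>n\<close> and \<open>p\<close> one takes \<open>q\<close> close to \<open>n\<^bsup>1/3\<^esup>\<close> and some of the paths, or \<open>q\<close> close to
  \<open>p\<^bsup>1/2\<^esup>\<close> and some of the points. This needs primes in every interval \<open>[x, K x]\<close>.
\<close>

section \<open>Bridges of length two\<close>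

lemma bridge_2_iff:
  "has_bridge P 2 \<longleftrightarrow> (\<exists>i j x y. i < length P \<and> j < length P \<and> i \<noteq> j \<and> x \<noteq> y \<and>
     precedes (P ! i) x y \<and> precedes (P ! j) x y)"
proof
  assume "has_bridge P 2"
  then obtain v q where "is_bridge P 2 v q" unfolding has_bridge_def by blast
  then have "q 0 < length P" "q 1 < length P" "q 0 \<noteq> q 1" "v 0 \<noteq> v 1"
    "precedes (P ! q 0) (v 0) (v 1)" "precedes (P ! q 1) (v 0) (v 1)"
    by (auto simp: is_bridge_def inj_on_def Ball_def less_2_cases_iff)
  then show "\<exists>i j x y. i < length P \<and> j < length P \<and> i \<noteq> j \<and> x \<noteq> y \<and>
     precedes (P ! i) x y \<and> precedes (P ! j) x y" by blast
next
  assume "\<exists>i j x y. i < length P \<and> j < length P \<and> i \<noteq> j \<and> x \<noteq> y \<and>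
     precedes (P ! i) x y \<and> precedes (P ! j) x y"
  then obtain i j x y where *: "i < length P" "j < length P" "i \<noteq> j" "x \<noteq> y"
    "precedes (P ! i) x y" "precedes (P ! j) x y" by blast
  have "is_bridge P 2 (\<lambda>k. if k = 0 then x else y) (\<lambda>k. if k = 0 then i else j)"
    using * by (auto simp: is_bridge_def inj_on_def less_2_cases_iff)
  then show "has_bridge P 2" unfolding has_bridge_def by blast
qed

lemma ordered_bridge_2_iff: "has_ordered_bridge P 2 \<longleftrightarrow> has_bridge P 2"
proof
  assume "has_bridge P 2"
  \<comment> \<open>\<open>bridge_2_iff\<close> is symmetric in the two paths, so the earlier one
    can be made the arc and the later one the river.\<close>
  then obtain i j x y where *: "i < j" "i < length P" "j < length P" "x \<noteq> y"
    "precedes (P ! i) x y" "precedes (P ! j) x y"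
    unfolding bridge_2_iff by (metis linorder_neqE_nat)
  have "is_bridge P 2 (\<lambda>k. if k = 0 then x else y) (\<lambda>k. if k = 0 then i else j)"
    using * by (auto simp: is_bridge_def inj_on_def less_2_cases_iff)
  then show "has_ordered_bridge P 2"
    unfolding has_ordered_bridge_def using \<open>i < j\<close>
    by (intro exI[of _ "\<lambda>k. if k = 0 then x else y"] exI[of _ "\<lambda>k. if k = 0 then i else j"]) auto
qed (auto simp: has_ordered_bridge_def has_bridge_def)

lemma no_bridge_0: "\<not> has_bridge P 0"
  by (simp add: has_bridge_def is_bridge_def)

lemma precedes_distinct: "precedes \<pi> x y \<Longrightarrow> distinct \<pi> \<Longrightarrow> x \<noteq> y"
  by (auto simp: precedes_def nth_eq_iff_index_eq)

text \<open>For \<open>b = 1\<close> the river would have to visit \<open>v 0\<close> strictly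
  before itself.\<close>

lemma no_bridge_1:
  assumes "path_system V P"
  shows "\<not> has_bridge P 1"
proof
  assume "has_bridge P 1"
  then obtain v q where "q 0 < length P" "precedes (P ! q 0) (v 0) (v 0)"
    by (auto simp: has_bridge_def is_bridge_def)
  moreover have "distinct (P ! q 0)"
    using assms calculation(1) by (auto simp: path_system_def)
  ultimately show False using precedes_distinct by blast
qed

lemma bridge_girth_gt_2_iff:
  assumes "path_system V P"
  shows "bridge_girth_gt P 2 \<longleftrightarrow> \<not> has_bridge P 2"
proof -
  have "b \<le> 2 \<longleftrightarrow> b = 0 \<or> b = 1 \<or> b = 2" for b :: nat by auto
  then show ?thesis
    using no_bridge_0 no_bridge_1[OF assms] unfolding bridge_girth_gt_def by auto
qed

lemma ordered_bridge_girth_gt_2_iff: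
  assumes "path_system V P"
  shows "ordered_bridge_girth_gt P 2 \<longleftrightarrow> \<not> has_bridge P 2"
proof -
  have "b \<le> 2 \<longleftrightarrow> b = 0 \<or> b = 1 \<or> b = 2" for b :: nat by auto
  moreover have "has_ordered_bridge P b \<Longrightarrow> has_bridge P b" for b
    by (auto simp: has_ordered_bridge_def has_bridge_def)
  ultimately show ?thesis
    using no_bridge_0 no_bridge_1[OF assms] ordered_bridge_2_iff
    unfolding ordered_bridge_girth_gt_def by (metis le_refl)
qed

lemma beta_2_eq_beta_star_2: "beta n p 2 = beta_star n p 2"
proof -
  have "{ps_size P | V P. path_system V P \<and> card V = n \<and> length P = p \<and> bridge_girth_gt P 2}
    = {ps_size P | V P. path_system V P \<and> card V = n \<and> length P = p \<and> ordered_bridge_girth_gt P 2}"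
    using bridge_girth_gt_2_iff ordered_bridge_girth_gt_2_iff by blast
  then show ?thesis by (simp add: beta_def beta_star_def)
qed

section \<open>Sizes of path systems and existence of the maximum\<close>

lemma ps_size_eq_sum: "ps_size P = (\<Sum>i<length P. length (P ! i))"
  by (simp add: ps_size_def sum_list_sum_nth atLeast0LessThan)

lemma ps_size_le:
  assumes "path_system V P"
  shows "ps_size P \<le> length P * card V"
proof -
  have "length (P ! i) \<le> card V" if "i < length P" for i
    using assms that unfolding path_system_def
    by (metis card_mono distinct_card nth_mem)
  then have "(\<Sum>i<length P. length (P ! i)) \<le> (\<Sum>i<length P. card V)"
    by (intro sum_mono) auto
  then show ?thesis by (simp add: ps_size_eq_sum)
qed

text \<open>\<open>Max\<close> is meaningful only on finite nonempty sets. Finiteness is shown here;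
  nonemptiness comes from the system of empty paths in \<open>beta_attained\<close>.\<close>

lemma finite_sizes:
  "finite {ps_size P | V P. path_system V P \<and> card V = n \<and> length P = p \<and> bridge_girth_gt P k}"
  by (rule finite_subset[of _ "{..p * n}"]) (use ps_size_le in auto)

lemma le_beta:
  assumes "path_system V P" "card V = n" "length P = p" "\<not> has_bridge P 2"
  shows "ps_size P \<le> beta n p 2"
  unfolding beta_def
  by (rule Max_ge[OF finite_sizes]) (use assms bridge_girth_gt_2_iff[OF assms(1)] in blast)

lemma beta_attained:
  obtains V P where "path_system V P" "card V = n" "length P = p" "\<not> has_bridge P 2"
    "ps_size P = beta n p 2"
proof -
  let ?S = "{ps_size P | V P. path_system V P \<and> card V = n \<and> length P = p \<and> bridge_girth_gt P 2}"
  let ?P = "replicate p [] :: nat list list"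
  have ps: "path_system {..<n} ?P" by (auto simp: path_system_def)
  have "\<not> has_bridge ?P 2" by (auto simp: bridge_2_iff precedes_def)
  then have "ps_size ?P \<in> ?S" using ps bridge_girth_gt_2_iff[OF ps]
    by (intro CollectI exI[of _ "{..<n}"] exI[of _ ?P]) auto
  then have "Max ?S \<in> ?S" by (intro Max_in finite_sizes) blast
  then obtain V P where "path_system V P" "card V = n" "length P = p" "bridge_girth_gt P 2"
    "ps_size P = beta n p 2" unfolding beta_def by auto
  then show ?thesis using that bridge_girth_gt_2_iff by blast
qed

section \<open>Upper bound\<close>

text \<open>A linear substitute for Cauchy-Schwarz: short paths are charged to \<open>t + 1\<close>,
  long ones to their pairs of nodes. The threshold \<open>t\<close> is optimised after summing over
  the paths.\<close>

lemma length_le_pair_count: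
  fixes t :: real
  assumes "t > 0"
  shows "real l \<le> t + 1 + real l * (real l - 1) / t"
proof (cases "real l \<le> t + 1")
  case True
  moreover have "real l * (real l - 1) / t \<ge> 0"
    using assms by (cases "l = 0") auto
  ultimately show ?thesis by linarith
next
  case False
  then have "real l * t \<le> real l * (real l - 1)" by (intro mult_left_mono) auto
  then have "real l \<le> real l * (real l - 1) / t" using assms by (simp add: field_simps)
  then show ?thesis using assms by linarith
qed

text \<open>The same device for triples of paths through a node. For \<open>d < 3\<close> truncated
  subtraction makes the product vanish.\<close>

lemma degree_le_triple_count:
  fixes t :: real
  assumes "t > 0"
  shows "real d \<le> t + 2 + real (d * (d - 1) * (d - 2)) / t\<^sup>2"
proof (cases "real d \<le> t + 2")
  case True
  moreover have "real (d * (d - 1) * (d - 2)) / t\<^sup>2 \<ge> 0" by simp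
  ultimately show ?thesis by linarith
next
  case False
  then have d: "d > 2" using assms by linarith
  have "t\<^sup>2 \<le> real (d - 1) * real (d - 2)"
    unfolding power2_eq_square using False d assms by (intro mult_mono) auto
  then have "real d * t\<^sup>2 \<le> real (d * (d - 1) * (d - 2))"
    by (simp add: mult.assoc mult_left_mono)
  then have "real d \<le> real (d * (d - 1) * (d - 2)) / t\<^sup>2" using assms by (simp add: field_simps)
  then show ?thesis using assms by linarith
qed

text \<open>Two paths through the same ordered pair of nodes would form a 2-bridge, so recording the
  nodes at two positions of a path is injective into \<open>V \<times> V\<close>.\<close>

lemma sum_pairs_le:
  assumes ps: "path_system V P" and nb: "\<not> has_bridge P 2"
  shows "(\<Sum>i<length P. length (P ! i) * (length (P ! i) - 1)) \<le> 2 * (card V)\<^sup>2"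
proof -
  \<comment> \<open>A path, a later position and an earlier one: a path of length \<open>l\<close>
    contributes \<open>l * (l - 1) / 2\<close> elements, whence the factor 2 in the claim.\<close>
  let ?J = "SIGMA i:{..<length P}. SIGMA k:{..<length (P ! i)}. {..<k}"
  let ?f = "\<lambda>(i, k, j). (P ! i ! j, P ! i ! k)"
  have dist: "distinct (P ! i)" "set (P ! i) \<subseteq> V" if "i < length P" for i
    using ps that by (auto simp: path_system_def)
  have "inj_on ?f ?J"
  proof (rule inj_onI)
    fix s s' assume s: "s \<in> ?J" "s' \<in> ?J" and eq: "?f s = ?f s'"
    obtain i k j i' k' j' where [simp]: "s = (i, k, j)" "s' = (i', k', j')"
      by (metis surj_pair)
    have pre: "precedes (P ! i) (P ! i ! j) (P ! i ! k)" "precedes (P ! i') (P ! i ! j) (P ! i ! k)"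
      using s eq by (auto simp: precedes_def)
    have "i = i'"
      using nb s pre dist(1) precedes_distinct[OF pre(1)] unfolding bridge_2_iff by auto
    then show "s = s'" using s eq dist(1)[of i] by (auto simp: nth_eq_iff_index_eq)
  qed
  moreover have "?f ` ?J \<subseteq> V \<times> V"
    using dist(2) by (fastforce simp: subset_iff)
  ultimately have "card ?J \<le> card (V \<times> V)"
    using ps by (intro card_inj_on_le) (auto simp: path_system_def)
  then have "2 * (\<Sum>i<length P. \<Sum>{..<length (P ! i)}) \<le> 2 * (card V)\<^sup>2"
    by (simp add: card_cartesian_product power2_eq_square)
  moreover have "2 * \<Sum>{..<l} = l * (l - 1)" for l :: nat
  proof (induction l)
    case (Suc l)
    then show ?case by (cases l) auto
  qed simp
  ultimately show ?thesis by (simp add: sum_distrib_left)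
qed

text \<open>Pigeonhole: there are only two orders in which a path can traverse two given
  nodes.\<close>

lemma three_paths_share_one_node:
  assumes ps: "path_system V P" and nb: "\<not> has_bridge P 2"
    and "i < length P" "j < length P" "k < length P" "distinct [i, j, k]"
    and v: "v \<in> set (P ! i)" "v \<in> set (P ! j)" "v \<in> set (P ! k)"
    and w: "w \<in> set (P ! i)" "w \<in> set (P ! j)" "w \<in> set (P ! k)"
  shows "v = w"
proof (rule ccontr)
  assume "v \<noteq> w"
  have *: "precedes \<pi> v w \<or> precedes \<pi> w v" if "v \<in> set \<pi>" "w \<in> set \<pi>" for \<pi>
    using that \<open>v \<noteq> w\<close> unfolding in_set_conv_nth precedes_def by (metis linorder_neqE_nat)
  have "\<not> (precedes (P ! i) x y \<and> precedes (P ! j) x y)"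
    "\<not> (precedes (P ! i) x y \<and> precedes (P ! k) x y)"
    "\<not> (precedes (P ! j) x y \<and> precedes (P ! k) x y)" if "x \<noteq> y" for x y
    using nb assms(3-6) that unfolding bridge_2_iff by auto
  then show False using *[OF v(1) w(1)] *[OF v(2) w(2)] *[OF v(3) w(3)] \<open>v \<noteq> w\<close> by metis
qed

lemma card_distinct_triples:
  assumes "finite A"
  shows "card {xs. length xs = 3 \<and> distinct xs \<and> set xs \<subseteq> A} = card A * (card A - 1) * (card A - 2)"
proof (cases "card A \<ge> 3")
  case True
  have "{card A - 3 + 1..card A} = {card A - 2, card A - 1, card A}" using True by auto
  moreover have "card A - 2 \<noteq> card A - 1" "card A - 1 \<noteq> card A" "card A - 2 \<noteq> card A"
    using True by auto
  ultimately show ?thesis using True assms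
    by (simp add: card_lists_distinct_length_eq del: One_nat_def)
next
  \<comment> \<open>No such lists exist, and one of the truncated factors is zero.\<close>
  case False
  have "length xs \<le> card A" if "distinct xs" "set xs \<subseteq> A" for xs
    using that assms by (metis card_mono distinct_card)
  then have "{xs. length xs = 3 \<and> distinct xs \<and> set xs \<subseteq> A} = {}" using False by fastforce
  moreover have "card A = 0 \<or> card A = 1 \<or> card A = 2" using False by linarith
  ultimately show ?thesis by (elim disjE) (simp_all only:, simp_all)
qed

definition node_degree :: "nat list list \<Rightarrow> nat \<Rightarrow> nat" where
  "node_degree P v = card {i. i < length P \<and> v \<in> set (P ! i)}"

lemma ps_size_eq_sum_degree:
  assumes "path_system V P"
  shows "ps_size P = (\<Sum>v\<in>V. node_degree P v)"
proof -
  have "ps_size P = (\<Sum>i<length P. card {v\<in>V. v \<in> set (P ! i)})"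
    unfolding ps_size_eq_sum
  proof (intro sum.cong refl)
    fix i assume "i \<in> {..<length P}"
    then have "distinct (P ! i)" "{v\<in>V. v \<in> set (P ! i)} = set (P ! i)"
      using assms by (auto simp: path_system_def)
    then show "length (P ! i) = card {v\<in>V. v \<in> set (P ! i)}" by (simp add: distinct_card)
  qed
  also have "\<dots> = (\<Sum>v\<in>V. card {i\<in>{..<length P}. v \<in> set (P ! i)})"
    using assms by (intro sum_multicount_gen[symmetric]) (auto simp: path_system_def)
  finally show ?thesis by (simp add: node_degree_def)
qed

text \<open>Three distinct paths meet in at most one node, so the sets \<open>T v\<close> of ordered
  triples of paths through \<open>v\<close> are disjoint, and all lie among the \<open>p ^ 3\<close>
  lists of three path indices, where \<open>p = length P\<close>.\<close>

lemma sum_triples_le: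
  assumes ps: "path_system V P" and nb: "\<not> has_bridge P 2"
  shows "(\<Sum>v\<in>V. node_degree P v * (node_degree P v - 1) * (node_degree P v - 2)) \<le> length P ^ 3"
proof -
  define D where "D v = {i. i < length P \<and> v \<in> set (P ! i)}" for v
  define T where "T v = {xs. length xs = 3 \<and> distinct xs \<and> set xs \<subseteq> D v}" for v
  have finD: "finite (D v)" for v by (simp add: D_def)
  have sub: "T v \<subseteq> {xs. set xs \<subseteq> {..<length P} \<and> length xs = 3}" for v
    by (auto simp: T_def D_def)
  have fin: "finite {xs. set xs \<subseteq> {..<length P} \<and> length xs = 3}"
    by (intro finite_lists_length_eq) auto
  have "T v \<inter> T w = {}" if "v \<noteq> w" for v w
  proof -
    have False if "xs \<in> T v" "xs \<in> T w" for xs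
    proof -
      obtain i j k where "xs = [i, j, k]" using \<open>xs \<in> T v\<close>
        by (auto simp: T_def length_Suc_conv numeral_3_eq_3)
      then show False
        using three_paths_share_one_node[OF ps nb, of i j k v w] that \<open>v \<noteq> w\<close>
        by (auto simp: T_def D_def)
    qed
    then show ?thesis by blast
  qed
  then have "(\<Sum>v\<in>V. card (T v)) = card (\<Union>v\<in>V. T v)"
    using ps finite_subset[OF sub fin] by (intro card_UN_disjoint[symmetric]) (auto simp: path_system_def)
  also have "\<dots> \<le> card {xs. set xs \<subseteq> {..<length P} \<and> length xs = 3}"
    using sub by (intro card_mono fin) blast
  also have "\<dots> = length P ^ 3" by (subst card_lists_length_eq) auto
  finally show ?thesis
    unfolding T_def card_distinct_triples[OF finD] by (simp add: node_degree_def D_def)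
qed

lemma ps_size_le_sqrt:
  assumes ps: "path_system V P" and nb: "\<not> has_bridge P 2" and V: "card V > 0" and P: "length P > 0"
  shows "real (ps_size P) \<le> 3 * (card V * sqrt (length P)) + length P"
proof -
  \<comment> \<open>This balances the two contributions: with \<open>n\<close> nodes and
    \<open>p\<close> paths, \<open>p * t\<close> and \<open>n^2 / t\<close> both equal
    \<open>n * sqrt p\<close>.\<close>
  let ?t = "card V / sqrt (length P)"
  have t: "?t > 0" using V P by simp
  have "real (ps_size P) \<le> (\<Sum>i<length P. ?t + 1 + length (P ! i) * (real (length (P ! i)) - 1) / ?t)"
    unfolding ps_size_eq_sum of_nat_sum by (intro sum_mono length_le_pair_count[OF t])
  also have "\<dots> = length P * (?t + 1) +
      (\<Sum>i<length P. length (P ! i) * (real (length (P ! i)) - 1)) / ?t"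
    by (simp add: sum.distrib sum_divide_distrib[symmetric] del: divide_divide_eq_right)
  also have "(\<Sum>i<length P. length (P ! i) * (real (length (P ! i)) - 1)) =
      real (\<Sum>i<length P. length (P ! i) * (length (P ! i) - 1))"
    unfolding of_nat_sum
  proof (intro sum.cong refl)
    show "length (P ! i) * (real (length (P ! i)) - 1) = real (length (P ! i) * (length (P ! i) - 1))" for i
      by (cases "length (P ! i)") (simp_all add: distrib_right)
  qed
  also have "\<dots> / ?t \<le> real (2 * (card V)\<^sup>2) / ?t"
    using t by (intro divide_right_mono of_nat_mono sum_pairs_le[OF ps nb]) simp
  also have "\<dots> = 2 * card V * sqrt (length P)"
    using V by (simp add: power2_eq_square)
  also have "length P * (?t + 1) = card V * sqrt (length P) + length P"
    using real_sqrt_mult_self[of "length P"] P by (simp add: field_simps)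
  finally show ?thesis by simp
qed

lemma ps_size_le_powr:
  assumes ps: "path_system V P" and nb: "\<not> has_bridge P 2" and V: "card V > 0" and P: "length P > 0"
  shows "real (ps_size P) \<le> 2 * (card V powr (2/3) * length P) + 2 * card V"
proof -
  let ?n = "real (card V)" and ?p = "real (length P)"
  \<comment> \<open>Chosen so that \<open>?n * t\<close> and \<open>?p ^ 3 / t^2\<close> both equal
    \<open>?n powr (2/3) * ?p\<close>.\<close>
  define t where "t = ?p / ?n powr (1/3)"
  have t: "t > 0" using V P by (simp add: t_def)
  have "real (ps_size P) \<le>
      (\<Sum>v\<in>V. t + 2 + real (node_degree P v * (node_degree P v - 1) * (node_degree P v - 2)) / t\<^sup>2)"
    unfolding ps_size_eq_sum_degree[OF ps] of_nat_sum
    by (intro sum_mono degree_le_triple_count[OF t])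
  also have "\<dots> = ?n * (t + 2) +
      real (\<Sum>v\<in>V. node_degree P v * (node_degree P v - 1) * (node_degree P v - 2)) / t\<^sup>2"
    by (simp add: sum.distrib sum_divide_distrib)
  also have "real (\<Sum>v\<in>V. node_degree P v * (node_degree P v - 1) * (node_degree P v - 2)) / t\<^sup>2 \<le> ?p ^ 3 / t\<^sup>2"
    unfolding of_nat_power[symmetric]
    by (intro divide_right_mono of_nat_mono sum_triples_le[OF ps nb]) simp
  also have "?p ^ 3 / t\<^sup>2 = ?n powr (2/3) * ?p"
  proof -
    have "(?n powr (1/3))\<^sup>2 = ?n powr (2/3)" by (simp add: power2_eq_square flip: powr_add)
    then show ?thesis using P by (simp add: t_def power_divide power2_eq_square power3_eq_cube)
  qed
  also have "?n * (t + 2) = ?n powr (2/3) * ?p + 2 * ?n"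
  proof -
    have "?n = ?n powr (2/3) * ?n powr (1/3)" using V by (simp flip: powr_add)
    then have "?n * t = ?n powr (2/3) * ?p" using V by (simp add: t_def divide_eq_eq)
    then show ?thesis by (simp add: algebra_simps)
  qed
  finally show ?thesis by (simp add: mult.commute)
qed

lemma beta_2_upper:
  assumes "n \<ge> 1" "p \<ge> 1"
  shows "real (beta n p 2) \<le> 3 * (min (n * sqrt p) (n powr (2/3) * p) + n + p)"
proof -
  obtain V P where P: "path_system V P" "card V = n" "length P = p" "\<not> has_bridge P 2"
    "ps_size P = beta n p 2" by (rule beta_attained)
  have "real (beta n p 2) \<le> 3 * (n * sqrt p) + p"
    using ps_size_le_sqrt[of V P] P assms by simp
  moreover have "real (beta n p 2) \<le> 2 * (n powr (2/3) * p) + 2 * n"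
    using ps_size_le_powr[of V P] P assms by simp
  moreover have "n * sqrt p \<ge> 0" "n powr (2/3) * p \<ge> 0" "real n \<ge> 0" "real p \<ge> 0" by auto
  ultimately show ?thesis unfolding min_def by (simp add: algebra_simps split: if_split; linarith)
qed

section \<open>Primes up to a constant factor\<close>

definition primorial :: "nat \<Rightarrow> nat" where
  "primorial n = \<Prod>{p. prime p \<and> p \<le> n}"

lemma finite_primes_le: "finite {p::nat. prime p \<and> p \<le> n}"
  by (rule finite_subset[of _ "{..n}"]) auto

lemma prod_primes_dvd_nat:
  fixes x :: nat
  assumes "finite S" "\<And>p. p \<in> S \<Longrightarrow> prime p \<and> p dvd x"
  shows "\<Prod>S dvd x"
  using assms
proof (induction S rule: finite_induct)
  case (insert p S)
  have "coprime p (\<Prod>S)"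
    using insert by (intro prod_coprime_right) (auto intro: primes_coprime)
  then show ?case using insert by (auto intro: divides_mult)
qed simp

text \<open>Such a prime divides the factorial of \<open>n\<close> but neither of the two factorials
  in the denominator of the binomial coefficient.\<close>

lemma prime_dvd_choose:
  fixes p :: nat
  assumes "prime p" "h < p" "p \<le> n" "n - h \<le> h" "h \<le> n"
  shows "p dvd (n choose h)"
proof -
  have "p dvd fact h * fact (n - h) * (n choose h)"
    using assms by (simp add: binomial_fact_lemma prime_dvd_fact_iff)
  moreover have "\<not> p dvd fact h" "\<not> p dvd fact (n - h)"
    using assms by (auto simp: prime_dvd_fact_iff)
  ultimately show ?thesis using \<open>prime p\<close> by (metis prime_dvd_mult_iff)
qed

text \<open>Induction by halving: the primes in the upper half of \<open>{1..n}\<close> divide a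
  binomial coefficient, which is at most \<open>2 ^ n\<close>.\<close>

lemma primorial_le: "primorial n \<le> 8 ^ n"
proof (induction n rule: less_induct)
  case (less n)
  show ?case
  proof (cases "n \<ge> 2")
    case False
    then have "{p::nat. prime p \<and> p \<le> n} = {}" by (auto dest: prime_ge_2_nat)
    then have "primorial n = 1" unfolding primorial_def by (simp only: prod.empty)
    then show ?thesis by simp
  next
    case True
    define h where "h = n - n div 2"
    have h: "h < n" "n - h \<le> h" "h \<le> n" using True by (auto simp: h_def)
    let ?S = "{p::nat. prime p \<and> h < p \<and> p \<le> n}"
    have fin: "finite ?S" by (rule finite_subset[of _ "{..n}"]) auto
    have "\<Prod>?S dvd (n choose h)"
      using prime_dvd_choose h fin by (intro prod_primes_dvd_nat) auto
    then have "\<Prod>?S \<le> (n choose h)" using h by (intro dvd_imp_le) auto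
    also have "\<dots> \<le> 2 ^ n" by (rule binomial_le_pow2)
    finally have S: "\<Prod>?S \<le> 2 ^ n" .
    have "{p::nat. prime p \<and> p \<le> n} = {p. prime p \<and> p \<le> h} \<union> ?S" using h by auto
    then have "primorial n = primorial h * \<Prod>?S"
      unfolding primorial_def using fin finite_primes_le by (simp add: prod.union_disjoint Int_def)
    also have "\<dots> \<le> 8 ^ h * 2 ^ n" using less h S by (intro mult_mono) auto
    \<comment> \<open>The rounding in \<open>n div 2\<close> is paid for by the base 8:
      \<open>n \<le> 3 * (n div 2)\<close> for \<open>n \<ge> 2\<close>, with equality at 3.\<close>
    also have "(2::nat) ^ n \<le> 2 ^ (3 * (n div 2))" using True by (intro power_increasing) auto
    also have "8 ^ h * (2::nat) ^ (3 * (n div 2)) = 8 ^ (h + n div 2)"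
      by (simp add: power_mult power_add)
    also have "h + n div 2 = n" by (simp add: h_def)
    finally show ?thesis by simp
  qed
qed

section \<open>Common multiples of initial segments and gaps between primes\<close>

text \<open>The rule of Leibniz's harmonic triangle: an entry is the sum of the two adjacent entries
  in the next row.\<close>

lemma inverse_binomial_recurrence:
  assumes "k < n"
  shows "1 / (real (n + 1) * (n choose k)) + 1 / (real (n + 1) * (n choose Suc k)) =
    1 / (real n * ((n - 1) choose k))"
proof -
  let ?c = "real ((n - 1) choose k)"
  have c: "?c > 0" using assms by simp
  have "real ((n - k) * (n choose k)) = real (n * ((n - 1) choose k))"
    by (simp only: binomial_absorb_comp)
  then have 1: "real (n choose k) = n * ?c / (n - k)" using assms by (simp add: field_simps)
  have "real (Suc k * (n choose Suc k)) = real (n * ((n - 1) choose k))"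
    by (simp only: binomial_absorption)
  then have 2: "real (n choose Suc k) = n * ?c / (k + 1)" by (simp add: field_simps)
  have "1 / (real (n + 1) * (n choose k)) + 1 / (real (n + 1) * (n choose Suc k)) =
     (real (n - k) + (k + 1)) / (real (n + 1) * (n * ?c))"
    unfolding 1 2 by (simp add: add_divide_distrib)
  also have "real (n - k) + (k + 1) = real (n + 1)" using assms by simp
  also have "real (n + 1) / (real (n + 1) * (n * ?c)) = 1 / (real n * ?c)" by simp
  finally show ?thesis .
qed

text \<open>
  Applied to a common multiple of \<open>1, \<dots>, N\<close> built from the primes up to \<open>N\<close>, this forces the
  multiple to grow like \<open>2\<^sup>N\<close>, hence some of these primes to be large.
\<close>

lemma leibniz_triangle_dvd:
  assumes "\<And>j. 1 \<le> j \<Longrightarrow> j \<le> n + 1 \<Longrightarrow> j dvd D" "k \<le> n"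
  shows "(n + 1) * (n choose k) dvd D"
proof -
  \<comment> \<open>Divisibility is recast as integrality of \<open>D\<close> times a triangle
    entry. The column \<open>k = 0\<close> is integral by assumption, and an entry of column
    \<open>Suc k\<close> is a difference of two entries of column \<open>k\<close>.\<close>
  have "real D / (real (n + 1) * (n choose k)) \<in> \<int>"
    using assms
  proof (induction k arbitrary: n)
    case 0
    then have "n + 1 dvd D" by simp
    then obtain c where "D = (n + 1) * c" by (rule dvdE)
    then have "real D / (real (n + 1) * (n choose 0)) = real c" by (simp add: field_simps)
    then show ?case by simp
  next
    case (Suc k)
    have 1: "real D / (real (n + 1) * (n choose k)) \<in> \<int>" using Suc by simp
    have "real D / (real (n - 1 + 1) * ((n - 1) choose k)) \<in> \<int>" using Suc by (intro Suc.IH) auto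
    then have 2: "real D / (real n * ((n - 1) choose k)) \<in> \<int>" using Suc.prems by simp
    have "real D / (real (n + 1) * (n choose Suc k)) =
        real D * (1 / (real n * ((n - 1) choose k)) - 1 / (real (n + 1) * (n choose k)))"
      using Suc.prems by (subst inverse_binomial_recurrence[symmetric]) simp_all
    also have "\<dots> = real D / (real n * ((n - 1) choose k)) - real D / (real (n + 1) * (n choose k))"
      by (simp add: algebra_simps)
    finally show ?case using Ints_diff[OF 2 1] by simp
  qed
  then obtain z where z: "real D / (real (n + 1) * (n choose k)) = of_int z" by (rule Ints_cases)
  have "real (n + 1) * (n choose k) > 0" using assms(2) by simp
  then have "real D = of_int z * (real (n + 1) * (n choose k))" using z by (simp add: field_simps)
  then have "of_int (int D) = (of_int (int ((n + 1) * (n choose k)) * z) :: real)" by (simp add: algebra_simps)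
  then have "int D = int ((n + 1) * (n choose k)) * z" by (simp only: of_int_eq_iff)
  then show ?thesis by (metis dvd_triv_left int_dvd_int_iff)
qed

text \<open>Without primes in \<open>{m<..N}\<close>, the primes up to \<open>m\<close> suffice to
  build a common multiple. Only primes with \<open>p * p \<le> N\<close>, of which there are at most
  \<open>s\<close>, can need an exponent above 1.\<close>

lemma common_multiple_bound:
  fixes N m s :: nat
  assumes no: "\<And>p. prime p \<Longrightarrow> m < p \<Longrightarrow> N < p" and N: "N \<ge> 1"
    and s: "\<And>p. p * p \<le> N \<Longrightarrow> p \<le> s"
  obtains D where "D > 0" "\<And>j. 1 \<le> j \<Longrightarrow> j \<le> N \<Longrightarrow> j dvd D" "D \<le> N ^ s * 8 ^ m"
proof -
  \<comment> \<open>The exponent of a prime \<open>p\<close> in the least common multiple of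
    \<open>1, ..., N\<close>.\<close>
  define e where "e p = Max {e. p ^ e \<le> N}" for p :: nat
  let ?Q = "{p::nat. prime p \<and> p \<le> m}"
  let ?D = "\<Prod>p\<in>?Q. p ^ e p"
  have fin: "finite {e. p ^ e \<le> N}" if "prime p" for p :: nat
  proof (rule finite_subset)
    have "f \<le> N" if "p ^ f \<le> N" for f
    proof -
      have "f \<le> 2 ^ f" by (simp add: less_imp_le)
      also have "(2::nat) ^ f \<le> p ^ f" using \<open>prime p\<close> by (intro power_mono prime_ge_2_nat) auto
      finally show ?thesis using that by simp
    qed
    then show "{e. p ^ e \<le> N} \<subseteq> {..N}" by auto
  qed simp
  have e_le: "p ^ e p \<le> N" if "prime p" for p :: nat
  proof -
    have "0 \<in> {e. p ^ e \<le> N}" using N by simp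
    then show ?thesis using Max_in[OF fin[OF that]] unfolding e_def by blast
  qed
  have le_e: "f \<le> e p" if "prime p" "p ^ f \<le> N" for p f :: nat
    using that fin unfolding e_def by (intro Max_ge) auto
  show thesis
  proof
    show "?D > 0" by (intro prod_pos) (auto intro: prime_gt_0_nat)
    show "j dvd ?D" if j: "1 \<le> j" "j \<le> N" for j
    proof -
      have "(\<Prod>p\<in>prime_factors j. p ^ multiplicity p j) dvd ?D"
      proof (rule prod_dvd_prod_subset2)
        show "finite ?Q" by (rule finite_primes_le)
        have le: "p \<le> N" if "p dvd j" for p using that j dvd_imp_le[of p j] by simp
        show "prime_factors j \<subseteq> ?Q"
        proof
          fix p assume "p \<in> prime_factors j"
          then have "prime p" "p dvd j" by auto
          then show "p \<in> ?Q" using le no by (metis linorder_not_less mem_Collect_eq)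
        qed
        show "p ^ multiplicity p j dvd p ^ e p" if "p \<in> prime_factors j" for p
        proof -
          have "p ^ multiplicity p j \<le> N" using le multiplicity_dvd by blast
          then show ?thesis using that le_e by (intro le_imp_power_dvd) auto
        qed
      qed
      then show ?thesis using prod_prime_factors[of j] j by simp
    qed
    \<comment> \<open>Small primes are granted the generous factor \<open>N * p\<close>, so that the
      factors \<open>p\<close> of all primes together form \<open>primorial m\<close>.\<close>
    have "?D \<le> (\<Prod>p\<in>?Q. (if p * p \<le> N then N else 1) * p)"
    proof (intro prod_mono conjI)
      fix p assume "p \<in> ?Q"
      then have p: "prime p" "p > 0" by (auto intro: prime_gt_0_nat)
      show "p ^ e p \<le> (if p * p \<le> N then N else 1) * p"
      proof (cases "p * p \<le> N")
        case True
        have "N * 1 \<le> N * p" using p by (intro mult_le_mono) auto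
        then show ?thesis using True e_le[OF p(1)] by (simp only: if_True)
      next
        case False
        have "e p \<le> 1"
        proof (rule ccontr)
          assume "\<not> e p \<le> 1"
          then have "p ^ 2 \<le> p ^ e p" using p by (intro power_increasing) auto
          then show False using False e_le[OF p(1)] by (simp add: power2_eq_square)
        qed
        then have "p ^ e p \<le> p ^ 1" using p by (intro power_increasing) auto
        then show ?thesis using False by simp
      qed
    qed simp
    also have "\<dots> = (\<Prod>p\<in>?Q. if p * p \<le> N then N else 1) * primorial m"
      by (simp add: prod.distrib primorial_def)
    also have "(\<Prod>p\<in>?Q. if p * p \<le> N then N else 1) = N ^ card {p\<in>?Q. p * p \<le> N}"
      by (subst prod.inter_filter[symmetric]) (auto simp: finite_primes_le)
    also have "\<dots> \<le> N ^ s"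
    proof (rule power_increasing)
      have "{p\<in>?Q. p * p \<le> N} \<subseteq> {1..s}" using s prime_ge_1_nat by auto
      then show "card {p\<in>?Q. p * p \<le> N} \<le> s" using card_mono[of "{1..s}"] by fastforce
    qed (use N in auto)
    also have "primorial m \<le> 8 ^ m" by (rule primorial_le)
    finally show "?D \<le> N ^ s * 8 ^ m" by simp
  qed
qed

text \<open>A gap would give a common multiple of \<open>1, ..., 8 * m + 1\<close> of size about
  \<open>8 ^ m\<close>, up to a factor \<open>(8 * m + 1) ^ s\<close> with \<open>s\<close> about
  \<open>sqrt (8 * m)\<close>. The central entry of the harmonic triangle forces at least
  \<open>4 ^ (4 * m)\<close>.\<close>

lemma prime_between_eventually:
  "\<exists>m0. \<forall>m\<ge>m0. \<exists>p::nat. prime p \<and> m < p \<and> p \<le> 8 * m + 1"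
proof -
  \<comment> \<open>The 5 is \<open>8 - 3\<close>, from the logarithms of \<open>4 ^ (4 * m)\<close>
    and \<open>8 ^ m\<close>.\<close>
  have "eventually (\<lambda>m::nat. 5 * m * ln 2 > sqrt (8 * real m + 1) * ln (8 * real m + 1)) at_top"
    by real_asymp
  then obtain m0 where m0: "\<And>m. m \<ge> m0 \<Longrightarrow> 5 * m * ln 2 > sqrt (8 * real m + 1) * ln (8 * real m + 1)"
    by (auto simp: eventually_at_top_linorder)
  show ?thesis
  proof (rule exI[of _ "max m0 1"], intro allI impI, rule ccontr)
    fix m assume m: "max m0 1 \<le> m" and "\<not> (\<exists>p. prime p \<and> m < p \<and> p \<le> 8 * m + 1)"
    then have no: "8 * m + 1 < p" if "prime p" "m < p" for p using that linorder_not_less by blast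
    define s where "s = nat \<lfloor>sqrt (8 * real m + 1)\<rfloor>"
    have s: "p \<le> s" if "p * p \<le> 8 * m + 1" for p
    proof -
      have "real (p * p) \<le> 8 * m + 1" using of_nat_mono[OF that, where ?'a = real] by simp
      then have "real p \<le> sqrt (8 * real m + 1)" by (intro real_le_rsqrt) (simp add: power2_eq_square)
      then show ?thesis unfolding s_def by (simp add: le_nat_floor)
    qed
    obtain D where D: "D > 0" "\<And>j. 1 \<le> j \<Longrightarrow> j \<le> 8 * m + 1 \<Longrightarrow> j dvd D"
      "D \<le> (8 * m + 1) ^ s * 8 ^ m"
      using common_multiple_bound[of m "8 * m + 1" s] no s by auto
    have "(8 * m + 1) * ((8 * m) choose (4 * m)) dvd D"
      using D(2) by (intro leibniz_triangle_dvd) auto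
    then have "(8 * m + 1) * ((8 * m) choose (4 * m)) \<le> D" using D(1) by (intro dvd_imp_le)
    then have "real ((8 * m + 1) * ((8 * m) choose (4 * m))) \<le> real ((8 * m + 1) ^ s * 8 ^ m)"
      using D(3) by (intro of_nat_mono) linarith
    moreover have "4 ^ (4 * m) \<le> real ((8 * m + 1) * ((8 * m) choose (4 * m)))"
    proof -
      have "4 ^ (4 * m) \<le> real ((2 * (4 * m)) choose (4 * m)) * (2 * real (4 * m))"
        using central_binomial_lower_bound[of "4 * m"] m by (simp only: pos_divide_le_eq)
      also have "\<dots> = real (((8 * m) choose (4 * m)) * (8 * m))" by simp
      also have "\<dots> \<le> real ((8 * m + 1) * ((8 * m) choose (4 * m)))"
        by (intro of_nat_mono) simp
      finally show ?thesis .
    qed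
    ultimately have "4 ^ (4 * m) \<le> real ((8 * m + 1) ^ s * 8 ^ m)" by linarith
    then have "ln (4 ^ (4 * m)) \<le> ln (real ((8 * m + 1) ^ s * 8 ^ m))" by (intro ln_mono) auto
    moreover have "ln (real ((8 * m + 1) ^ s * 8 ^ m)) = s * ln (8 * real m + 1) + m * ln 8"
      using m by (simp add: ln_mult ln_realpow add.commute)
    moreover have "ln (4 ^ (4 * m)) = 8 * m * ln (2::real)"
    proof -
      have "(4::real) ^ (4 * m) = 2 ^ (8 * m)" by (simp add: power_mult)
      then show ?thesis by (simp add: ln_realpow)
    qed
    moreover have "ln 8 = 3 * ln (2::real)" using ln_realpow[of "2::real" 3] by simp
    moreover have "s * ln (8 * real m + 1) \<le> sqrt (8 * real m + 1) * ln (8 * real m + 1)"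
      unfolding s_def by (intro mult_right_mono) auto
    ultimately have "5 * m * ln 2 \<le> sqrt (8 * real m + 1) * ln (8 * real m + 1)" by simp
    then show False using m0[of m] m by simp
  qed
qed

lemma odd_prime_near:
  "\<exists>K::nat. \<forall>x\<ge>3. \<exists>q. prime q \<and> 3 \<le> q \<and> q \<le> x \<and> x \<le> K * q"
proof -
  obtain m0 where m0: "\<And>m. m \<ge> m0 \<Longrightarrow> \<exists>p::nat. prime p \<and> m < p \<and> p \<le> 8 * m + 1"
    using prime_between_eventually by blast
  \<comment> \<open>The 3 guarantees that primes found above \<open>M\<close> satisfy
    \<open>3 \<le> q\<close>.\<close>
  define M where "M = max m0 3"
  show ?thesis
  proof (rule exI[of _ "8 * M + 9"], intro allI impI)
    fix x :: nat assume x: "3 \<le> x"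
    let ?m = "(x - 1) div 8"
    have x_le: "8 * ?m + 1 \<le> x" "x \<le> 8 * ?m + 8" using x by auto
    show "\<exists>q. prime q \<and> 3 \<le> q \<and> q \<le> x \<and> x \<le> (8 * M + 9) * q"
    proof (cases "?m \<ge> M")
      case True
      then obtain q where q: "prime q" "?m < q" "q \<le> 8 * ?m + 1" using m0[of ?m] by (auto simp: M_def)
      have "x \<le> 8 * q" using x_le q by linarith
      also have "\<dots> \<le> (8 * M + 9) * q" by (intro mult_right_mono) auto
      finally show ?thesis using q x_le True by (intro exI[of _ q]) (auto simp: M_def)
    next
      case False
      \<comment> \<open>The remaining \<open>x\<close> are bounded in terms of \<open>M\<close>, so
        the prime 3 serves them all.\<close>
      then show ?thesis using x x_le by (intro exI[of _ 3]) auto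
    qed
  qed
qed

section \<open>Lower bound\<close>

text \<open>Each \<open>S i\<close> becomes a path sorted by \<open>key i\<close>; elements are
  renumbered by naturals and empty paths pad the list to length \<open>p\<close>. Since
  \<open>sep\<close> compares keys non-strictly, it excludes 2-bridges however ties are
  broken.\<close>

lemma sum_card_le_beta:
  fixes S :: "'i \<Rightarrow> 'a set" and key :: "'i \<Rightarrow> 'a \<Rightarrow> nat"
  assumes W: "finite W" "card W \<le> n" and I: "finite I" "card I \<le> p"
    and S: "\<And>i. i \<in> I \<Longrightarrow> S i \<subseteq> W"
    and sep: "\<And>i j u v. i \<in> I \<Longrightarrow> j \<in> I \<Longrightarrow> i \<noteq> j \<Longrightarrow> u \<in> S i \<inter> S j \<Longrightarrow> v \<in> S i \<inter> S j \<Longrightarrow>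
      key i u \<le> key i v \<Longrightarrow> key j u \<le> key j v \<Longrightarrow> u = v"
  shows "(\<Sum>i\<in>I. card (S i)) \<le> beta n p 2"
proof -
  obtain g where g: "bij_betw g W {0..<card W}" using ex_bij_betw_finite_nat[OF W(1)] by blast
  define h where "h = inv_into W g"
  have inj: "inj_on g W" and range: "g ` W = {0..<card W}" using g by (auto simp: bij_betw_def)
  have h: "h (g w) = w" if "w \<in> W" for w using inj that by (simp add: h_def)
  obtain Is where Is: "set Is = I" "distinct Is" using finite_distinct_list[OF I(1)] by blast
  then have len: "length Is = card I" by (metis distinct_card)
  define path where "path i = sort_key (\<lambda>m. key i (h m)) (sorted_list_of_set (g ` S i))" for i
  define P where "P = map path Is @ replicate (p - card I) []"
  have fin: "finite (g ` S i)" if "i \<in> I" for i using S[OF that] W(1) by (metis finite_imageI finite_subset)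
  have set_path: "set (path i) = g ` S i" if "i \<in> I" for i using fin[OF that] by (simp add: path_def)
  have distinct_path: "distinct (path i)" for i by (simp add: path_def)
  have length_path: "length (path i) = card (S i)" if "i \<in> I" for i
    using inj_on_subset[OF inj S[OF that]] by (simp add: path_def card_image)
  have length_P: "length P = p" using I len by (simp add: P_def)
  have nth_P: "P ! j = (if j < length Is then path (Is ! j) else [])" if "j < p" for j
    using that len by (simp add: P_def nth_append)
  have "path_system {..<n} P"
    unfolding path_system_def
  proof (intro conjI ballI)
    fix \<pi> assume "\<pi> \<in> set P"
    then consider "\<pi> = []" | i where "i \<in> I" "\<pi> = path i" using Is by (auto simp: P_def)
    note cs = this
    show "distinct \<pi>" using cs distinct_path by cases auto
    show "set \<pi> \<subseteq> {..<n}"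
      using cs
    proof cases
      case (2 i)
      then have "set \<pi> \<subseteq> g ` W" using set_path S by blast
      then show ?thesis using range W(2) by fastforce
    qed simp
  qed simp
  moreover have "\<not> has_bridge P 2"
  proof
    assume "has_bridge P 2"
    then obtain i j x y where ij: "i < p" "j < p" "i \<noteq> j" "x \<noteq> y"
      "precedes (P ! i) x y" "precedes (P ! j) x y" unfolding bridge_2_iff length_P by blast
    then have less: "i < length Is" "j < length Is"
      using nth_P by (auto simp: precedes_def split: if_splits)
    let ?i = "Is ! i" and ?j = "Is ! j"
    have I': "?i \<in> I" "?j \<in> I" "?i \<noteq> ?j" using less Is ij(3) by (auto simp: nth_eq_iff_index_eq)
    have key: "key k (h x) \<le> key k (h y)" if "precedes (path k) x y" for k
    proof -
      from that obtain a b where ab: "a < b" "b < length (path k)" "path k ! a = x" "path k ! b = y"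
        by (auto simp: precedes_def)
      have "sorted (map (\<lambda>m. key k (h m)) (path k))" by (simp add: path_def)
      from sorted_nth_mono[OF this, of a b] show ?thesis using ab by simp
    qed
    have in_path: "x \<in> set \<pi> \<and> y \<in> set \<pi>" if "precedes \<pi> x y" for \<pi>
      using that by (auto simp: precedes_def)
    have pre: "precedes (path ?i) x y" "precedes (path ?j) x y" using ij nth_P less by auto
    have "h u \<in> S k" if "k \<in> I" "u \<in> set (path k)" for k u
      using that set_path S h by fastforce
    then have mem: "h x \<in> S ?i \<inter> S ?j" "h y \<in> S ?i \<inter> S ?j" using I' in_path pre by auto
    have "h x = h y" using sep[OF I' mem key[OF pre(1)] key[OF pre(2)]] .
    moreover have "g (h u) = u" if "k \<in> I" "u \<in> set (path k)" for k u
      using that set_path S h by fastforce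
    ultimately have "x = y" using I' in_path pre by metis
    then show False using ij by simp
  qed
  ultimately have "ps_size P \<le> beta n p 2" using length_P by (intro le_beta) auto
  moreover have "ps_size P = (\<Sum>i\<in>I. card (S i))"
    using Is length_path by (simp add: ps_size_def P_def sum_list_distinct_conv_sum_set comp_def sum_list_replicate)
  ultimately show ?thesis by simp
qed

text \<open>One path through all nodes. Together with the single-node paths of
  \<open>beta_ge_paths\<close> this yields the additive terms \<open>n\<close> and \<open>p\<close>,
  and also settles small parameters later.\<close>

lemma beta_ge_nodes: "p \<ge> 1 \<Longrightarrow> n \<le> beta n p 2"
  using sum_card_le_beta[of "{..<n}" n "{()}" p "\<lambda>_. {..<n}" "\<lambda>_ v. v"] by simp

lemma beta_ge_paths: "n \<ge> 1 \<Longrightarrow> p \<le> beta n p 2"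
  using sum_card_le_beta[of "{()}" n "{..<p}" p "\<lambda>_. {()}" "\<lambda>_ _. 0"] by simp

section \<open>Quadratic polynomials over a prime field\<close>

definition cube :: "int \<Rightarrow> (int \<times> int \<times> int) set" where
  "cube q = {0..<q} \<times> {0..<q} \<times> {0..<q}"

text \<open>The derivative at \<open>a\<close> of the polynomial
  \<open>x + y T + z T^2\<close>.\<close>

definition plane_key :: "int \<Rightarrow> int \<times> int \<Rightarrow> int \<times> int \<times> int \<Rightarrow> int" where
  "plane_key q = (\<lambda>(a, c) (x, y, z). (y + 2 * a * z) mod q)"

text \<open>With keys in the lower half, two differences of keys add up to less than
  \<open>q\<close> in absolute value, so a sum divisible by \<open>q\<close> is zero.\<close>

definition plane :: "int \<Rightarrow> int \<times> int \<Rightarrow> (int \<times> int \<times> int) set" where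
  "plane q = (\<lambda>(a, c). {(x, y, z) \<in> cube q. (x + a * y + a * a * z) mod q = c \<and>
     2 * plane_key q (a, c) (x, y, z) < q})"

lemma eq_of_dvd_diff_int:
  fixes q :: int
  assumes "q dvd u - v" "u \<in> {0..<q}" "v \<in> {0..<q}"
  shows "u = v"
  using assms by (metis atLeastLessThan_iff mod_eq_dvd_iff mod_pos_pos_trivial)

text \<open>The two key differences sum to exactly zero and are both nonpositive, hence vanish. Then
  \<open>u - v\<close> has a double root at \<open>a\<close> and another root at \<open>b\<close>,
  too many for degree two.\<close>

lemma planes_separated:
  fixes q :: int
  assumes q: "prime q" and i: "i \<in> {0..<q} \<times> {0..<q}" and j: "j \<in> {0..<q} \<times> {0..<q}" and "i \<noteq> j"
    and u: "u \<in> plane q i \<inter> plane q j" and v: "v \<in> plane q i \<inter> plane q j"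
    and key: "plane_key q i u \<le> plane_key q i v" "plane_key q j u \<le> plane_key q j v"
  shows "u = v"
proof -
  obtain a c b d where ij: "i = (a, c)" "j = (b, d)" by (metis surj_pair)
  obtain x y z x' y' z' where uv: "u = (x, y, z)" "v = (x', y', z')" by (metis surj_pair)
  have range: "a \<in> {0..<q}" "b \<in> {0..<q}" "x \<in> {0..<q}" "y \<in> {0..<q}" "z \<in> {0..<q}"
    "x' \<in> {0..<q}" "y' \<in> {0..<q}" "z' \<in> {0..<q}"
    using i j u v unfolding ij uv plane_def cube_def by auto
  have eqs: "(x + a * y + a * a * z) mod q = c" "(x' + a * y' + a * a * z') mod q = c"
    "(x + b * y + b * b * z) mod q = d" "(x' + b * y' + b * b * z') mod q = d"
    using u v unfolding ij uv plane_def by auto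
  \<comment> \<open>For \<open>a = b\<close> the common point \<open>u\<close> has only one value
    there, forcing \<open>c = d\<close>.\<close>
  have "a \<noteq> b" using eqs \<open>i \<noteq> j\<close> ij by auto
  then have nd: "\<not> q dvd a - b" using eq_of_dvd_diff_int range by blast
  define X Y Z where "X = x - x'" and "Y = y - y'" and "Z = z - z'"
  have A: "q dvd X + a * Y + a * a * Z"
  proof -
    have "q dvd (x + a * y + a * a * z) - (x' + a * y' + a * a * z')" using eqs by (metis mod_eq_dvd_iff)
    then show ?thesis by (simp add: X_def Y_def Z_def algebra_simps)
  qed
  have B: "q dvd X + b * Y + b * b * Z"
  proof -
    have "q dvd (x + b * y + b * b * z) - (x' + b * y' + b * b * z')" using eqs by (metis mod_eq_dvd_iff)
    then show ?thesis by (simp add: X_def Y_def Z_def algebra_simps)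
  qed
  have "q dvd (a - b) * (Y + (a + b) * Z)"
    using dvd_diff[OF A B] by (simp add: algebra_simps)
  \<comment> \<open>Twice this slope is the sum of the derivatives \<open>Y + 2 * a * Z\<close> and
    \<open>Y + 2 * b * Z\<close>.\<close>
  then have AB: "q dvd Y + (a + b) * Z" using nd q by (metis prime_dvd_mult_iff)
  define fu where "fu = (y + 2 * a * z) mod q"
  define fv where "fv = (y' + 2 * a * z') mod q"
  define gu where "gu = (y + 2 * b * z) mod q"
  define gv where "gv = (y' + 2 * b * z') mod q"
  have q0: "q > 0" using q by (simp add: prime_gt_0_int)
  have small: "0 \<le> fu" "0 \<le> fv" "0 \<le> gu" "0 \<le> gv" "2 * fu < q" "2 * fv < q" "2 * gu < q" "2 * gv < q"
    using u v q0 unfolding ij uv plane_def plane_key_def fu_def fv_def gu_def gv_def by auto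
  have le: "fu \<le> fv" "gu \<le> gv" using key unfolding ij uv plane_key_def fu_def fv_def gu_def gv_def by auto
  have "q dvd (y' + 2 * a * z' - fv) - (y + 2 * a * z - fu)"
    "q dvd (y' + 2 * b * z' - gv) - (y + 2 * b * z - gu)"
    unfolding fu_def fv_def gu_def gv_def by (intro dvd_diff dvd_minus_mod)+
  then have f: "q dvd (fu - fv) - (Y + 2 * a * Z)" and g: "q dvd (gu - gv) - (Y + 2 * b * Z)"
    by (simp_all add: Y_def Z_def algebra_simps)
  have "q dvd (fu - fv) + (gu - gv)"
    using dvd_add[OF dvd_add[OF f g] dvd_mult[OF AB, of 2]] by (simp add: algebra_simps)
  moreover have "\<bar>(fu - fv) + (gu - gv)\<bar> < q" using small by linarith
  ultimately have "(fu - fv) + (gu - gv) = 0"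
    using dvd_imp_le_int[of "(fu - fv) + (gu - gv)" q] q0 by linarith
  then have "fu - fv = 0" using le by linarith
  then have F: "q dvd Y + 2 * a * Z" using f by (simp only: diff_0 dvd_minus_iff)
  have "q dvd (a - b) * Z" using dvd_diff[OF F AB] by (simp add: algebra_simps)
  then have Z: "q dvd Z" using nd q by (metis prime_dvd_mult_iff)
  then have Y: "q dvd Y" using AB by (simp add: dvd_add_left_iff)
  then have X: "q dvd X" using A Z by (simp add: dvd_add_left_iff)
  have "x = x'" "y = y'" "z = z'"
    using X Y Z range eq_of_dvd_diff_int unfolding X_def Y_def Z_def by blast+
  then show ?thesis by (simp add: uv)
qed

lemma card_halves:
  fixes q :: int
  assumes "q > 0"
  shows "nat q \<le> 2 * card {f\<in>{0..<q}. 2 * f < q}"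
proof -
  have "{f\<in>{0..<q}. 2 * f < q} = {0..<(q + 1) div 2}" using assms by auto
  then show ?thesis using assms by simp
qed

text \<open>The value \<open>c\<close> and derivative \<open>f\<close> at \<open>a\<close> together
  with the leading coefficient \<open>z\<close> determine the polynomial, which
  \<open>?\<phi>\<close> reconstructs. Here \<open>z\<close> is free and \<open>f\<close> ranges
  over the lower half.\<close>

lemma card_plane_ge:
  fixes q :: int
  assumes "q > 0" "c \<in> {0..<q}"
  shows "nat q * nat q \<le> 2 * card (plane q (a, c))"
proof -
  let ?H = "{f\<in>{0..<q}. 2 * f < q}"
  let ?y = "\<lambda>z f. (f - 2 * a * z) mod q"
  let ?\<phi> = "\<lambda>(z, f). ((c - a * ?y z f - a * a * z) mod q, ?y z f, z)"
  have "inj_on ?\<phi> ({0..<q} \<times> ?H)"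
  proof (rule inj_onI)
    fix s s' assume s: "s \<in> {0..<q} \<times> ?H" "s' \<in> {0..<q} \<times> ?H" and eq: "?\<phi> s = ?\<phi> s'"
    obtain z f z' f' where zf: "s = (z, f)" "s' = (z', f')" by (metis surj_pair)
    have "z = z'" "?y z f = ?y z f'" using eq by (auto simp: zf)
    moreover from this have "f = f'"
      using s eq_of_dvd_diff_int[of q f f'] by (auto simp: zf mod_eq_dvd_iff)
    ultimately show "s = s'" by (simp add: zf)
  qed
  moreover have "?\<phi> ` ({0..<q} \<times> ?H) \<subseteq> plane q (a, c)"
  proof clarify
    fix z f assume z: "z \<in> {0..<q}" and f: "f \<in> {0..<q}" "2 * f < q"
    have "((c - a * ?y z f - a * a * z) mod q + a * ?y z f + a * a * z) mod q = c mod q"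
      by (subst mod_add_left_eq[symmetric], subst mod_add_left_eq[symmetric]) (simp add: mod_add_left_eq)
    moreover have "(?y z f + 2 * a * z) mod q = f mod q" by (simp add: mod_simps)
    ultimately show "((c - a * ?y z f - a * a * z) mod q, ?y z f, z) \<in> plane q (a, c)"
      using assms z f by (simp add: plane_def cube_def plane_key_def)
  qed
  moreover have "finite (plane q (a, c))"
    by (rule finite_subset[of _ "cube q"]) (auto simp: plane_def cube_def)
  ultimately have "card ({0..<q} \<times> ?H) \<le> card (plane q (a, c))" by (rule card_inj_on_le)
  then have "nat q * card ?H \<le> card (plane q (a, c))" by (simp add: card_cartesian_product)
  moreover have "nat q * nat q \<le> nat q * (2 * card ?H)"
    by (intro mult_left_mono card_halves assms) simp
  ultimately show ?thesis by linarith
qed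

text \<open>Since \<open>q\<close> is odd and \<open>z \<noteq> 0\<close>, the derivative
  \<open>F a\<close> runs through every residue once as \<open>a\<close> varies. Each
  \<open>a\<close> with \<open>F a\<close> in the lower half gives one plane, \<open>c\<close> being
  the value of \<open>u\<close> at \<open>a\<close>.\<close>

lemma card_planes_through_ge:
  fixes q :: int
  assumes q: "prime q" "q > 2" and u: "u = (x, y, z)" "u \<in> cube q" "z \<noteq> 0"
  shows "nat q \<le> 2 * card {i \<in> {0..<q} \<times> {0..<q}. u \<in> plane q i}"
proof -
  let ?H = "{f\<in>{0..<q}. 2 * f < q}"
  define F where "F a = (y + 2 * a * z) mod q" for a
  have z: "\<not> q dvd z" using u eq_of_dvd_diff_int[of q z 0] q by (auto simp: cube_def)
  have two: "\<not> q dvd 2" using q zdvd_imp_le[of q 2] by auto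
  have "inj_on F {0..<q}"
  proof (rule inj_onI)
    fix a b assume ab: "a \<in> {0..<q}" "b \<in> {0..<q}" "F a = F b"
    then have "q dvd (y + 2 * a * z) - (y + 2 * b * z)" by (simp add: F_def mod_eq_dvd_iff)
    then have "q dvd 2 * ((a - b) * z)" by (simp add: algebra_simps)
    then have "q dvd a - b" using z two q(1) by (simp only: prime_dvd_mult_iff simp_thms)
    then show "a = b" using ab eq_of_dvd_diff_int by blast
  qed
  moreover have "F ` {0..<q} \<subseteq> {0..<q}" using q by (auto simp: F_def)
  ultimately have "F ` {0..<q} = {0..<q}" by (intro endo_inj_surj) auto
  then have "?H \<subseteq> F ` {a\<in>{0..<q}. 2 * F a < q}" by fastforce
  moreover have "finite {a\<in>{0..<q}. 2 * F a < q}" by (rule finite_subset[of _ "{0..<q}"]) auto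
  ultimately have "card ?H \<le> card {a\<in>{0..<q}. 2 * F a < q}" by (intro surj_card_le)
  also have "\<dots> \<le> card {i \<in> {0..<q} \<times> {0..<q}. u \<in> plane q i}"
  proof (rule card_inj_on_le)
    let ?\<psi> = "\<lambda>a. (a, (x + a * y + a * a * z) mod q)"
    show "inj_on ?\<psi> {a\<in>{0..<q}. 2 * F a < q}" by (auto intro: inj_onI)
    show "?\<psi> ` {a\<in>{0..<q}. 2 * F a < q} \<subseteq> {i \<in> {0..<q} \<times> {0..<q}. u \<in> plane q i}"
      using u q by (auto simp: plane_def plane_key_def F_def)
    show "finite {i \<in> {0..<q} \<times> {0..<q}. u \<in> plane q i}"
      by (rule finite_subset[of _ "{0..<q} \<times> {0..<q}"]) auto
  qed
  finally show ?thesis using card_halves[of q] q by linarith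
qed

lemma sum_card_planes_le_beta:
  fixes q :: int
  assumes "prime q" "I \<subseteq> {0..<q} \<times> {0..<q}" "card I \<le> p" "W \<subseteq> cube q" "card W \<le> n"
  shows "(\<Sum>i\<in>I. card (plane q i \<inter> W)) \<le> beta n p 2"
proof (rule sum_card_le_beta[where key = "\<lambda>i u. nat (plane_key q i u)"])
  show "finite W" "finite I" using assms finite_subset by (auto simp: cube_def intro: finite_subset)
  fix i j u v assume *: "i \<in> I" "j \<in> I" "i \<noteq> j" "u \<in> plane q i \<inter> W \<inter> (plane q j \<inter> W)"
    "v \<in> plane q i \<inter> W \<inter> (plane q j \<inter> W)" "nat (plane_key q i u) \<le> nat (plane_key q i v)"
    "nat (plane_key q j u) \<le> nat (plane_key q j v)"
  have "plane_key q k w \<ge> 0" for k w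
    using prime_gt_0_int[OF assms(1)] by (simp add: plane_key_def split: prod.split)
  then have "plane_key q i u \<le> plane_key q i v" "plane_key q j u \<le> plane_key q j v"
    using *(6,7) by (metis nat_0_le of_nat_le_iff)+
  moreover have "i \<in> {0..<q} \<times> {0..<q}" "j \<in> {0..<q} \<times> {0..<q}" using *(1,2) assms(2) by auto
  ultimately show "u = v" using *(3-5) by (intro planes_separated[OF assms(1), of i j]) blast+
qed (use assms in auto)

text \<open>All \<open>q ^ 3\<close> points and \<open>k\<close> of the planes, each with at least
  half of \<open>q^2\<close> points.\<close>

lemma beta_ge_few_paths:
  fixes q :: nat
  assumes "prime q" "q ^ 3 \<le> n" "k \<le> q\<^sup>2" "k \<le> p"
  shows "k * q\<^sup>2 \<le> 2 * beta n p 2"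
proof -
  have q: "prime (int q)" "q > 0" using assms by (auto intro: prime_gt_0_nat)
  have "card ({0..<int q} \<times> {0..<int q}) = q\<^sup>2" by (simp add: card_cartesian_product power2_eq_square)
  then obtain I where I: "I \<subseteq> {0..<int q} \<times> {0..<int q}" "card I = k"
    using obtain_subset_with_card_n assms(3) by metis
  have "card (cube q) = q ^ 3" by (simp add: cube_def card_cartesian_product power3_eq_cube)
  then have "(\<Sum>i\<in>I. card (plane q i \<inter> cube q)) \<le> beta n p 2"
    using assms q I by (intro sum_card_planes_le_beta) auto
  moreover have "(\<Sum>i\<in>I. q\<^sup>2) \<le> (\<Sum>i\<in>I. 2 * card (plane q i \<inter> cube q))"
  proof (rule sum_mono)
    fix i assume "i \<in> I"
    then obtain a c where i: "i = (a, c)" "c \<in> {0..<int q}" using I by blast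
    have "plane q i \<inter> cube q = plane q i" by (auto simp: plane_def)
    then show "q\<^sup>2 \<le> 2 * card (plane q i \<inter> cube q)"
      using card_plane_ge[of "int q" c a] q i by (simp add: power2_eq_square)
  qed
  ultimately show ?thesis using I(2) by (simp add: sum_distrib_left[symmetric])
qed

text \<open>All \<open>q^2\<close> planes and \<open>k\<close> of the points, each on at least half
  of \<open>q\<close> planes. The points are taken with \<open>z \<noteq> 0\<close>, as
  \<open>card_planes_through_ge\<close> demands.\<close>

lemma beta_ge_many_paths:
  fixes q :: nat
  assumes "prime q" "q \<ge> 3" "q\<^sup>2 \<le> p" "k \<le> q\<^sup>2 * (q - 1)" "k \<le> n"
  shows "k * q \<le> 2 * beta n p 2"
proof -
  let ?I = "{0..<int q} \<times> {0..<int q}"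
  let ?C = "{0..<int q} \<times> {0..<int q} \<times> {1..<int q}"
  have q: "prime (int q)" "int q > 2" using assms by auto
  have cI: "card ?I = q\<^sup>2" by (simp add: card_cartesian_product power2_eq_square)
  have "card ?C = q\<^sup>2 * (q - 1)" using assms by (simp add: card_cartesian_product power2_eq_square nat_diff_distrib)
  then obtain W where W: "W \<subseteq> ?C" "card W = k"
    using obtain_subset_with_card_n assms(4) by metis
  have WC: "W \<subseteq> cube q" using W by (auto simp: cube_def)
  then have finW: "finite W" by (rule finite_subset) (simp add: cube_def)
  have "(\<Sum>i\<in>?I. card (plane q i \<inter> W)) \<le> beta n p 2"
    using assms q W WC cI by (intro sum_card_planes_le_beta) auto
  \<comment> \<open>Double counting of the incidences between planes and points.\<close>
  moreover have "(\<Sum>i\<in>?I. card (plane q i \<inter> W)) = (\<Sum>u\<in>W. card {i\<in>?I. u \<in> plane q i})"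
    using sum_multicount_gen[of W ?I "\<lambda>u i. u \<in> plane q i" "\<lambda>i. card (plane q i \<inter> W)"] finW
    by (simp add: Int_def conj_commute)
  moreover have "(\<Sum>u\<in>W. q) \<le> (\<Sum>u\<in>W. 2 * card {i\<in>?I. u \<in> plane q i})"
  proof (rule sum_mono)
    fix u assume "u \<in> W"
    then have u: "u \<in> ?C" "u \<in> cube q" using W WC by blast+
    obtain x y z where xyz: "u = (x, y, z)" by (metis surj_pair)
    then have "z \<noteq> 0" using u(1) by auto
    from card_planes_through_ge[OF q xyz u(2) this]
    show "q \<le> 2 * card {i\<in>?I. u \<in> plane q i}" by (simp only: nat_int)
  qed
  ultimately show ?thesis using W(2) by (simp add: sum_distrib_left[symmetric])
qed

section \<open>Choice of the prime for general parameters\<close>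

lemma floor_root_prime:
  fixes r :: real
  assumes K: "\<forall>x\<ge>3. \<exists>q. prime q \<and> 3 \<le> q \<and> q \<le> x \<and> x \<le> K * (q::nat)" and r: "r \<ge> 3"
  obtains q :: nat where "prime q" "3 \<le> q" "real q \<le> r" "r \<le> 2 * real K * real q"
proof -
  define x where "x = nat \<lfloor>r\<rfloor>"
  have x: "x \<ge> 3" using r by (simp add: x_def le_nat_iff le_floor_iff)
  then obtain q where q: "prime q" "3 \<le> q" "q \<le> x" "x \<le> K * q" using K by blast
  have x_le: "real x \<le> r" "r < real x + 1" using r by (auto simp: x_def)
  have "real q \<le> r" using q(3) x_le by linarith
  moreover have "real x \<le> real K * real q" using of_nat_mono[OF q(4), where ?'a = real] by simp
  \<comment> \<open>The factor 2 absorbs the rounding, as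
    \<open>r < x + 1 \<le> 2 * x\<close>.\<close>
  then have "r \<le> 2 * real K * real q" using x_le x by linarith
  ultimately show thesis using that q by blast
qed

text \<open>The prime \<open>q\<close> is close to the cube root of \<open>n\<close>. As
  \<open>p\<close> is at most about \<open>q^2\<close>, cutting it down to \<open>k\<close> costs
  only a constant factor.\<close>

lemma beta_lower_few_paths:
  fixes n p :: nat
  assumes K: "\<forall>x\<ge>3. \<exists>q. prime q \<and> 3 \<le> q \<and> q \<le> x \<and> x \<le> K * (q::nat)" "K \<ge> 1"
    and n: "n \<ge> 1" and p: "p \<le> n powr (2/3)"
  shows "n powr (2/3) * p \<le> 64 * real K ^ 4 * beta n p 2"
proof -
  define r where "r = real n powr (1/3)"
  have r2: "n powr (2/3) = r\<^sup>2" by (simp add: r_def power2_eq_square flip: powr_add)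
  have r3: "r ^ 3 = n" using n by (simp add: r_def power3_eq_cube flip: powr_add)
  have r0: "r \<ge> 0" by (simp add: r_def)
  have K4: "real K ^ 4 \<ge> 1" using K(2) by simp
  show ?thesis
  proof (cases "r \<ge> 3")
    case False
    \<comment> \<open>No prime is available for \<open>r < 3\<close>, but the claim then follows
      from \<open>p \<le> beta n p 2\<close>.\<close>
    then have "r\<^sup>2 \<le> 3\<^sup>2" using r0 by (intro power_mono) auto
    then have "r\<^sup>2 * p \<le> 9 * real p" by (intro mult_right_mono) auto
    also have "\<dots> \<le> (64 * real K ^ 4) * beta n p 2"
      using K4 beta_ge_paths[OF n, of p] by (intro mult_mono) auto
    finally show ?thesis by (simp add: r2)
  next
    case True
    obtain q where q: "prime q" "3 \<le> q" "real q \<le> r" "r \<le> 2 * real K * real q"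
      using floor_root_prime[OF K(1) True] by blast
    define k where "k = min p (q\<^sup>2)"
    have "real q ^ 3 \<le> r ^ 3" using q by (intro power_mono) auto
    then have "q ^ 3 \<le> n" unfolding r3 by (simp only: of_nat_le_iff flip: of_nat_power)
    then have kq: "k * q\<^sup>2 \<le> 2 * beta n p 2" using q by (intro beta_ge_few_paths) (auto simp: k_def)
    have b: "real k * (real q)\<^sup>2 \<le> 2 * real (beta n p 2)"
      using of_nat_mono[OF kq, where ?'a = real] by simp
    have r2_le: "r\<^sup>2 \<le> 4 * (real K)\<^sup>2 * (real q)\<^sup>2"
      using power_mono[OF q(4) r0, of 2] by (simp add: power_mult_distrib)
    have "real p \<le> 4 * (real K)\<^sup>2 * real k"
    proof (cases "p \<le> q\<^sup>2")
      case True
      have "(real K)\<^sup>2 \<ge> 1" using K(2) by simp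
      then have "1 * real p \<le> 4 * (real K)\<^sup>2 * real p" by (intro mult_right_mono) auto
      then show ?thesis using True by (simp add: k_def)
    next
      case False
      then show ?thesis using p r2 r2_le by (simp add: k_def)
    qed
    then have "r\<^sup>2 * p \<le> (4 * (real K)\<^sup>2 * (real q)\<^sup>2) * (4 * (real K)\<^sup>2 * real k)"
      using r2_le by (intro mult_mono) auto
    also have "\<dots> = 16 * real K ^ 4 * (real k * (real q)\<^sup>2)" by (simp add: power4_eq_xxxx power2_eq_square)
    also have "\<dots> \<le> 16 * real K ^ 4 * (2 * real (beta n p 2))" using b by (intro mult_left_mono) auto
    also have "\<dots> \<le> 64 * real K ^ 4 * beta n p 2" by simp
    finally show ?thesis by (simp add: r2)
  qed
qed

text \<open>The prime \<open>q\<close> is close to \<open>sqrt p\<close>. As \<open>n\<close> is at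
  most \<open>r ^ 3\<close>, hence of order at most \<open>q ^ 3\<close>, using only
  \<open>k\<close> points costs a constant factor.\<close>

lemma beta_lower_many_paths:
  fixes n p :: nat
  assumes K: "\<forall>x\<ge>3. \<exists>q. prime q \<and> 3 \<le> q \<and> q \<le> x \<and> x \<le> K * (q::nat)" "K \<ge> 1"
    and p: "p \<ge> 1" "n powr (2/3) \<le> p"
  shows "n * sqrt p \<le> 64 * real K ^ 4 * beta n p 2"
proof -
  define r where "r = sqrt p"
  have r2: "r\<^sup>2 = p" by (simp add: r_def)
  have r0: "r \<ge> 0" by (simp add: r_def)
  have K4: "real K ^ 4 \<ge> 1" using K(2) by simp
  show ?thesis
  proof (cases "r \<ge> 3")
    case False
    then have "n * r \<le> real n * 3" by (intro mult_left_mono) auto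
    also have "\<dots> = 3 * real n" by simp
    also have "\<dots> \<le> (64 * real K ^ 4) * beta n p 2"
      using K4 beta_ge_nodes[OF p(1), of n] by (intro mult_mono) auto
    finally show ?thesis by (simp add: r_def)
  next
    case True
    obtain q where q: "prime q" "3 \<le> q" "real q \<le> r" "r \<le> 2 * real K * real q"
      using floor_root_prime[OF K(1) True] by blast
    define k where "k = min n (q\<^sup>2 * (q - 1))"
    have "(real q)\<^sup>2 \<le> r\<^sup>2" using q by (intro power_mono) auto
    then have "q\<^sup>2 \<le> p" unfolding r2 by (simp only: of_nat_le_iff flip: of_nat_power)
    then have kq: "k * q \<le> 2 * beta n p 2" using q by (intro beta_ge_many_paths) (auto simp: k_def)
    have b: "real k * real q \<le> 2 * real (beta n p 2)"
      using of_nat_mono[OF kq, where ?'a = real] by simp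
    have "real n = (n powr (2/3)) powr (3/2)" by (simp add: powr_powr)
    also have "\<dots> \<le> real p powr (3/2)" using p by (intro powr_mono2) auto
    also have "\<dots> = p powr (1/2) * p powr (1/2) * p powr (1/2)"
      by (simp only: powr_add[symmetric]) simp
    also have "\<dots> = r ^ 3"
      by (simp only: r_def powr_half_sqrt[OF of_nat_0_le_iff] power3_eq_cube)
    also have "\<dots> \<le> (2 * real K * real q) ^ 3" using q r0 by (intro power_mono) auto
    also have "\<dots> = 8 * real K ^ 3 * real q ^ 3" by (simp add: power_mult_distrib)
    finally have n_le: "real n \<le> 8 * real K ^ 3 * real q ^ 3" .
    have "real n \<le> 16 * real K ^ 3 * real k"
    proof (cases "n \<le> q\<^sup>2 * (q - 1)")
      case True
      have "real K ^ 3 \<ge> 1" using K(2) by simp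
      then have "1 * real n \<le> 16 * real K ^ 3 * real n" by (intro mult_right_mono) auto
      then show ?thesis using True by (simp add: k_def)
    next
      case False
      then have "real k = (real q)\<^sup>2 * (real q - 1)" using q by (simp add: k_def)
      \<comment> \<open>This compensates for the discarded points with \<open>z = 0\<close>.\<close>
      moreover have "(real q)\<^sup>2 * real q \<le> (real q)\<^sup>2 * (2 * (real q - 1))"
        using q by (intro mult_left_mono) auto
      ultimately have "real q ^ 3 \<le> 2 * real k" by (simp add: power3_eq_cube power2_eq_square algebra_simps)
      then have "8 * real K ^ 3 * real q ^ 3 \<le> 8 * real K ^ 3 * (2 * real k)" by (intro mult_left_mono) auto
      then show ?thesis using n_le by linarith
    qed
    then have "n * r \<le> (16 * real K ^ 3 * real k) * (2 * real K * real q)"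
      using q r0 by (intro mult_mono) auto
    also have "\<dots> = 32 * real K ^ 4 * (real k * real q)" by (simp add: power4_eq_xxxx power3_eq_cube)
    also have "\<dots> \<le> 32 * real K ^ 4 * (2 * real (beta n p 2))" using b by (intro mult_left_mono) auto
    finally show ?thesis by (simp add: r_def)
  qed
qed

theorem theorem3p1:
  "\<exists>c C :: real. c > 0 \<and> C > 0 \<and>
     (\<forall>n p :: nat. n \<ge> 1 \<longrightarrow> p \<ge> 1 \<longrightarrow>
        beta n p 2 = beta_star n p 2 \<and>
        c * (min (real n * sqrt (real p)) (real n powr (2/3) * real p) + real n + real p)
          \<le> real (beta n p 2) \<and>
        real (beta n p 2)
          \<le> C * (min (real n * sqrt (real p)) (real n powr (2/3) * real p) + real n + real p))"
proof -
  obtain K where K: "\<forall>x\<ge>3. \<exists>q. prime q \<and> 3 \<le> q \<and> q \<le> x \<and> x \<le> K * (q::nat)"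
    using odd_prime_near by blast
  \<comment> \<open>The instance \<open>x = 3\<close> rules out \<open>K = 0\<close>.\<close>
  then obtain q where "3 \<le> K * q" by blast
  then have K1: "K \<ge> 1" by (cases K) auto
  \<comment> \<open>The 2 accounts for the terms \<open>n\<close> and \<open>p\<close>.\<close>
  define M where "M = 64 * real K ^ 4 + 2"
  have M: "M > 0" by (simp add: M_def add_nonneg_pos)
  have lower: "1 / M * (min (n * sqrt p) (n powr (2/3) * p) + n + p) \<le> beta n p 2"
    if "n \<ge> 1" "p \<ge> 1" for n p :: nat
  proof -
    \<comment> \<open>The cases \<open>p \<le> n powr (2/3)\<close> and
      \<open>n powr (2/3) \<le> p\<close> each bound one argument of the minimum.\<close>
    have "min (n * sqrt p) (n powr (2/3) * p) \<le> 64 * real K ^ 4 * beta n p 2"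
      using beta_lower_few_paths[OF K K1, of n p] beta_lower_many_paths[OF K K1, of p n] that
      by (meson linear min.coboundedI1 min.coboundedI2)
    moreover have "real n \<le> beta n p 2" "real p \<le> beta n p 2"
      using beta_ge_nodes beta_ge_paths that by auto
    ultimately have "min (n * sqrt p) (n powr (2/3) * p) + n + p \<le> M * beta n p 2"
      unfolding M_def distrib_right by linarith
    then show ?thesis using M by (simp add: field_simps)
  qed
  show ?thesis
    using M lower beta_2_upper beta_2_eq_beta_star_2
    by (intro exI[of _ "1 / M"] exI[of _ 3] conjI allI impI) auto
qed

end
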